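(* Let $f:\{0,1\}^n\to\{0,1\}$ be non-zero. Then $$\mathrm{VC}(\mathrm{Spec}(f))\ge\deg_{\mathbb{F}_2}(f).$$ Consequently, $$\mathrm{VC}(\mathrm{supp}(f))+\mathrm{VC}(\mathrm{Spec}(f))\ge n.$$ In particular, if $\mathrm{VC}(\mathrm{supp}(f))=d$, then $\mathrm{Spec}(f)$ shatters a set of size at least $n-d$.
   Context: $[n]=\{1,\dots,n\}$. The real Fourier expansion of $f:\{0,1\}^n\to\{0,1\}\subset\mathbb{R}$ is $f=\sum_{S\subseteq[n]}\hat f(S)\chi_S$ with $\chi_S(x)=(-1)^{\sum_{i\in S}x_i}$, i.e. $\hat f(S)=2^{-n}\sum_{x\in\{0,1\}^n}f(x)\chi_S(x)$. The Fourier support is $\mathrm{Spec}(f):=\{S\subseteq[n]:\hat f(S)\neq0\}$, a family of subsets of $[n]$. Regarding $f$ as $\mathbb{F}_2$-valued, it has a unique multilinear representation $f(x)=\sum_{S\subseteq[n]}c_S\prod_{i\in S}x_i$ with $c_S\in\mathbb{F}_2$, and $\deg_{\mathbb{F}_2}(f):=\max\{|S|:c_S\neq0\}$. The support is $\mathrm{supp}(f):=\{x\in\{0,1\}^n:f(x)\neq0\}$; each $x\in\{0,1\}^n$ is identified with the set $\{i:x_i=1\}\subseteq[n]$, so $\mathrm{supp}(f)$ is also a family of subsets of $[n]$. A family $\mathcal{A}\subseteq 2^{[n]}$ shatters $T\subseteq[n]$ if for every $B\subseteq T$ there is $A\in\mathcal{A}$ with $A\cap T=B$; $\mathrm{VC}(\mathcal{A})$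 is the maximum size of a set shattered by $\mathcal{A}$. *)

theory Defs
  imports Complex_Main "HOL-Library.FuncSet" "HOL-Library.Z2"
begin

text \<open>
  Points of the cube are extensional functions on \<open>{1..n}\<close>, so that \<open>cube n\<close> has
  exactly \<open>2 ^ n\<close> elements. The values of a function on the cube are natural numbers
  (0 or 1), read as reals through \<open>real\<close> and as elements of the two-element field
  \<open>bit\<close> through \<open>of_nat\<close>; its values outside \<open>cube n\<close> never matter.
\<close>

definition cube :: "nat \<Rightarrow> (nat \<Rightarrow> nat) set" where
  "cube n = {1..n} \<rightarrow>\<^sub>E {0, 1}"

definition character :: "nat set \<Rightarrow> (nat \<Rightarrow> nat) \<Rightarrow> real" where
  "character S x = (- 1) ^ (\<Sum>i\<in>S. x i)"

definition fourier_coeff :: "nat \<Rightarrow> ((nat \<Rightarrow> nat) \<Rightarrow> nat) \<Rightarrow> nat set \<Rightarrow> real" where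
  "fourier_coeff n f S = (1 / 2 ^ n) * (\<Sum>x\<in>cube n. real (f x) * character S x)"

definition Spec :: "nat \<Rightarrow> ((nat \<Rightarrow> nat) \<Rightarrow> nat) \<Rightarrow> nat set set" where
  "Spec n f = {S. S \<subseteq> {1..n} \<and> fourier_coeff n f S \<noteq> 0}"

text \<open>
  A multilinear representation over \<open>bit\<close> is a coefficient function on the subsets of
  \<open>{1..n}\<close>; it is required to vanish elsewhere, which makes it unique as a total function.
\<close>

definition multilinear_rep ::
    "nat \<Rightarrow> ((nat \<Rightarrow> nat) \<Rightarrow> nat) \<Rightarrow> (nat set \<Rightarrow> bit) \<Rightarrow> bool" where
  "multilinear_rep n f c \<longleftrightarrow>
     (\<forall>S. \<not> S \<subseteq> {1..n} \<longrightarrow> c S = 0) \<and>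
     (\<forall>x\<in>cube n. of_nat (f x) = (\<Sum>S\<in>Pow {1..n}. c S * (\<Prod>i\<in>S. of_nat (x i))))"

definition multilinear_coeff ::
    "nat \<Rightarrow> ((nat \<Rightarrow> nat) \<Rightarrow> nat) \<Rightarrow> nat set \<Rightarrow> bit" where
  "multilinear_coeff n f = (THE c. multilinear_rep n f c)"

text \<open>For the zero function this is \<open>Max {}\<close>, which is unspecified.\<close>

definition degree_F2 :: "nat \<Rightarrow> ((nat \<Rightarrow> nat) \<Rightarrow> nat) \<Rightarrow> nat" where
  "degree_F2 n f = Max (card ` {S. S \<subseteq> {1..n} \<and> multilinear_coeff n f S \<noteq> 0})"

definition point_set :: "nat \<Rightarrow> (nat \<Rightarrow> nat) \<Rightarrow> nat set" where
  "point_set n x = {i \<in> {1..n}. x i = 1}"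

definition supp :: "nat \<Rightarrow> ((nat \<Rightarrow> nat) \<Rightarrow> nat) \<Rightarrow> nat set set" where
  "supp n f = point_set n ` {x \<in> cube n. f x \<noteq> 0}"

definition shatters :: "nat set set \<Rightarrow> nat set \<Rightarrow> bool" where
  "shatters F T \<longleftrightarrow> (\<forall>B. B \<subseteq> T \<longrightarrow> (\<exists>A\<in>F. A \<inter> T = B))"

text \<open>
  The maximum is over a finite set, and it is over a nonempty one as soon as \<open>F\<close> is
  nonempty, since \<open>F\<close> then shatters the empty set.
\<close>

definition VC :: "nat \<Rightarrow> nat set set \<Rightarrow> nat" where
  "VC n F = Max (card ` {T. T \<subseteq> {1..n} \<and> shatters F T})"

text \<open>The description in \<open>multilinear_coeff\<close> is proper.\<close>

lemma multilinear_rep_iff: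
  "multilinear_rep n f c \<longleftrightarrow>
     (\<forall>S. \<not> S \<subseteq> {1..n} \<longrightarrow> c S = 0) \<and>
     (\<forall>U\<in>Pow {1..n}. of_nat (f (\<lambda>i\<in>{1..n}. of_bool (i \<in> U))) = sum c (Pow U))"
proof -
  let ?p = "\<lambda>U. \<lambda>i\<in>{1..n}. of_bool (i \<in> U) :: nat"
  have cube: "cube n = ?p ` Pow {1..n}"
  proof (intro equalityI subsetI)
    fix x assume x: "x \<in> cube n"
    have "x = ?p (point_set n x)"
    proof
      fix i show "x i = ?p (point_set n x) i"
        using x unfolding cube_def point_set_def
        by (cases "i \<in> {1..n}") (auto simp: PiE_def Pi_def extensional_def)
    qed
    moreover have "point_set n x \<in> Pow {1..n}" by (auto simp: point_set_def)
    ultimately show "x \<in> ?p ` Pow {1..n}" by blast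
  qed (auto simp: cube_def)
  have "(\<Sum>S\<in>Pow {1..n}. c S * (\<Prod>i\<in>S. of_nat (?p U i))) = sum c (Pow U)"
    if U: "U \<in> Pow {1..n}" for U
  proof -
    have "c S * (\<Prod>i\<in>S. of_nat (?p U i)) = (if S \<in> Pow U then c S else 0)"
      if S: "S \<in> Pow {1..n}" for S
    proof -
      have fin: "finite S" using S by (auto intro: finite_subset)
      have eq: "(\<Prod>i\<in>S. of_nat (?p U i)) = (\<Prod>i\<in>S. of_bool (i \<in> U) :: bit)"
        using S by (intro prod.cong) (auto simp: subset_iff)
      show ?thesis
      proof (cases "S \<subseteq> U")
        case True
        then have "(\<Prod>i\<in>S. of_bool (i \<in> U) :: bit) = 1" by (intro prod.neutral) auto
        then show ?thesis using True eq by simp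
      next
        case False
        then obtain i where i: "i \<in> S" "i \<notin> U" by blast
        have "(\<Prod>i\<in>S. of_bool (i \<in> U) :: bit) = 0"
          by (rule prod_zero[OF fin]) (use i in force)
        then show ?thesis using False eq by simp
      qed
    qed
    then have "(\<Sum>S\<in>Pow {1..n}. c S * (\<Prod>i\<in>S. of_nat (?p U i)))
        = (\<Sum>S\<in>Pow {1..n}. if S \<in> Pow U then c S else 0)"
      by (rule sum.cong[OF refl])
    also have "\<dots> = sum c (Pow {1..n} \<inter> Pow U)"
      by (rule sum.inter_restrict[symmetric]) simp
    also have "Pow {1..n} \<inter> Pow U = Pow U" using U by blast
    finally show ?thesis .
  qed
  then show ?thesis by (simp add: multilinear_rep_def cube)
qed

lemma sum_Pow_cancel:
  fixes c d :: "'a set \<Rightarrow> 'b::ab_group_add"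
  assumes "finite V" and eq: "\<And>U. U \<subseteq> V \<Longrightarrow> sum c (Pow U) = sum d (Pow U)"
    and "U \<subseteq> V"
  shows "c U = d U"
proof -
  have "finite U" using assms(1,3) finite_subset by blast
  then show ?thesis using assms(3)
  proof (induction U rule: finite_psubset_induct)
    case (psubset U)
    have split: "sum g (Pow U) = g U + sum g (Pow U - {U})" for g :: "'a set \<Rightarrow> 'b"
      using psubset.hyps by (intro sum.remove) auto
    have "sum c (Pow U - {U}) = sum d (Pow U - {U})"
      by (rule sum.cong[OF refl], rule psubset.IH) (use psubset.prems in auto)
    then show ?case using eq[OF psubset.prems] split[of c] split[of d] by simp
  qed
qed

lemma ex1_multilinear_rep: "\<exists>!c. multilinear_rep n f c"
proof (rule ex_ex1I)
  let ?X = "Pow {1..n} \<rightarrow>\<^sub>E (UNIV :: bit set)"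
  let ?M = "\<lambda>c. \<lambda>U\<in>Pow {1..n}. sum c (Pow U) :: bit"
  have bits: "(UNIV :: bit set) = {0, 1}" using bit_not_zero_iff by blast
  have "finite ?X" by (rule finite_PiE) (simp_all add: bits)
  moreover have "?M ` ?X \<subseteq> ?X" by (intro image_subsetI restrict_PiE_iff[THEN iffD2]) simp
  moreover have "inj_on ?M ?X"
  proof (rule inj_onI)
    fix c d assume c: "c \<in> ?X" and d: "d \<in> ?X" and M: "?M c = ?M d"
    have "sum c (Pow U) = sum d (Pow U)" if "U \<subseteq> {1..n}" for U
      using fun_cong[OF M, of U] that by simp
    then have "c U = d U" if "U \<subseteq> {1..n}" for U
      using sum_Pow_cancel[of "{1..n}" c d U] that by simp
    then show "c = d" using c d by (intro PiE_ext) auto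
  qed
  ultimately have surj: "?M ` ?X = ?X" by (rule endo_inj_surj)
  let ?g = "\<lambda>U\<in>Pow {1..n}. of_nat (f (\<lambda>i\<in>{1..n}. of_bool (i \<in> U))) :: bit"
  have "?g \<in> ?M ` ?X" unfolding surj by (intro restrict_PiE_iff[THEN iffD2]) simp
  then obtain c where c: "?g = ?M c" by blast
  have "multilinear_rep n f (\<lambda>S. if S \<subseteq> {1..n} then c S else 0)"
    unfolding multilinear_rep_iff
  proof (intro conjI ballI)
    fix U assume U: "U \<in> Pow {1..n}"
    have "of_nat (f (\<lambda>i\<in>{1..n}. of_bool (i \<in> U))) = sum c (Pow U)"
      using fun_cong[OF c, of U] U by simp
    also have "\<dots> = (\<Sum>S\<in>Pow U. if S \<subseteq> {1..n} then c S else 0)"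
      using U by (intro sum.cong) auto
    finally show "of_nat (f (\<lambda>i\<in>{1..n}. of_bool (i \<in> U)))
        = (\<Sum>S\<in>Pow U. if S \<subseteq> {1..n} then c S else 0)" .
  qed simp
  then show "\<exists>c. multilinear_rep n f c" by blast
next
  fix c d assume c: "multilinear_rep n f c" and d: "multilinear_rep n f d"
  have "sum c (Pow U) = sum d (Pow U)" if "U \<subseteq> {1..n}" for U
    using c d that unfolding multilinear_rep_iff by (metis PowI)
  then have "c S = d S" if "S \<subseteq> {1..n}" for S
    using sum_Pow_cancel[of "{1..n}" c d S] that by simp
  moreover have "c S = d S" if "\<not> S \<subseteq> {1..n}" for S
    using c d that by (simp add: multilinear_rep_def)
  ultimately show "c = d" by blast
qed

lemma multilinear_rep_multilinear_coeff: "multilinear_rep n f (multilinear_coeff n f)"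
  unfolding multilinear_coeff_def by (rule theI'[of "multilinear_rep n f", OF ex1_multilinear_rep])

end

theory Submission
  imports Defs
begin

text \<open>
  Let \<open>c\<close> be the family of multilinear coefficients of \<open>f\<close> over the two-element field. Everything
  rests on one identity modulo 2 (\<open>sum_subcube_eq_sum_coeffs\<close>): for disjoint \<open>S\<close> and \<open>B\<close>, summing
  \<open>f\<close> over the points \<open>W \<union> B\<close> with \<open>W \<subseteq> S\<close> gives the sum of \<open>c (S \<union> A)\<close> over \<open>A \<subseteq> B\<close>. This is the
  coefficient of the monomial \<open>S\<close> after the variables outside \<open>S\<close> have been fixed to \<open>B\<close>.

  The spectrum shatters every \<open>T\<close> with \<open>c T \<noteq> 0\<close> (\<open>shatters_Spec\<close>). Suppose a pattern \<open>B \<subseteq> T\<close> is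
  missed. Then all Fourier coefficients at \<open>B \<union> A\<close> with \<open>A\<close> disjoint from \<open>T\<close> vanish, and their sum
  is, up to a nonzero factor, the Fourier coefficient at \<open>B\<close> of the restriction of \<open>f\<close> obtained by
  setting the variables outside \<open>T\<close> to 0. So the values of \<open>f\<close> on this subcube, taken with certain
  signs, add up to 0. Signs are invisible modulo 2, hence the plain sum of these values is even; but
  modulo 2 that sum is \<open>c T\<close>.

  The support shatters the complement of every \<open>S\<close> such that \<open>c S \<noteq> 0\<close> and \<open>c\<close> vanishes on all
  proper supersets of \<open>S\<close> (\<open>shatters_supp\<close>): whatever values are given to the variables outside \<open>S\<close>,
  the coefficient of the monomial \<open>S\<close> in the restricted function is still \<open>c S\<close>, so the restriction
  is not zero.

  A monomial \<open>S\<close> of maximal degree satisfies both conditions. Its size is the degree of \<open>f\<close>, and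
  that of its complement is \<open>n\<close> minus the degree.
\<close>

section \<open>Points of the cube as subsets\<close>

definition indicator_point :: "nat \<Rightarrow> nat set \<Rightarrow> nat \<Rightarrow> nat" where
  "indicator_point n U = (\<lambda>i\<in>{1..n}. of_bool (i \<in> U))"

lemma indicator_point_apply: "i \<in> {1..n} \<Longrightarrow> indicator_point n U i = of_bool (i \<in> U)"
  by (simp add: indicator_point_def)

lemma point_set_indicator_point: "U \<subseteq> {1..n} \<Longrightarrow> point_set n (indicator_point n U) = U"
  by (auto simp: point_set_def indicator_point_def)

lemma indicator_point_point_set:
  assumes "x \<in> cube n"
  shows "indicator_point n (point_set n x) = x"
proof
  fix i show "indicator_point n (point_set n x) i = x i"
    using assms unfolding cube_def point_set_def indicator_point_def
    by (cases "i \<in> {1..n}") (auto simp: PiE_def Pi_def extensional_def)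
qed

lemma bij_betw_indicator_point: "bij_betw (indicator_point n) (Pow {1..n}) (cube n)"
proof (rule bij_betw_byWitness[where f' = "point_set n"])
  show "indicator_point n ` Pow {1..n} \<subseteq> cube n"
    by (auto simp: cube_def indicator_point_def)
qed (auto simp: point_set_indicator_point indicator_point_point_set, auto simp: point_set_def)

lemma indicator_point_in_cube: "U \<subseteq> {1..n} \<Longrightarrow> indicator_point n U \<in> cube n"
  using bij_betwE[OF bij_betw_indicator_point] by blast

lemma of_nat_eq_sum_multilinear_coeff:
  assumes "U \<subseteq> {1..n}"
  shows "of_nat (f (indicator_point n U)) = sum (multilinear_coeff n f) (Pow U)"
  using multilinear_rep_multilinear_coeff[of n f] assms
  unfolding multilinear_rep_iff indicator_point_def by blast

section \<open>Coefficients as sums over subcubes\<close>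

lemma bit_add_self: "x + x = (0 :: bit)"
  by (cases "x = 0") simp_all

lemma sum_Pow_insert:
  assumes "finite S" "a \<notin> S"
  shows "sum g (Pow (insert a S)) = sum g (Pow S) + (\<Sum>W\<in>Pow S. g (insert a W))"
proof -
  have "inj_on (insert a) (Pow S)" using assms(2) by (auto intro!: inj_onI)
  moreover have "Pow S \<inter> insert a ` Pow S = {}" using assms(2) by auto
  ultimately show ?thesis
    using assms(1) by (simp add: Pow_insert sum.union_disjoint sum.reindex)
qed

text \<open>
  For \<open>B = {}\<close> this is Moebius inversion modulo 2. Letting \<open>B\<close> vary makes the induction on \<open>S\<close>
  work: a new element \<open>a\<close> is either left out of \<open>W\<close> or moved into \<open>B\<close>. Coefficients of sets without
  \<open>a\<close> arise in both cases and cancel modulo 2.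
\<close>

lemma sum_subcube_eq_sum_coeffs:
  fixes c :: "'a set \<Rightarrow> bit"
  assumes "finite S" "finite B" "S \<inter> B = {}"
  shows "(\<Sum>W\<in>Pow S. sum c (Pow (W \<union> B))) = (\<Sum>A\<in>Pow B. c (S \<union> A))"
  using assms
proof (induction S arbitrary: B)
  case empty
  then show ?case by simp
next
  case (insert a S)
  then have B: "a \<notin> B" "S \<inter> B = {}" by auto
  have "(\<Sum>W\<in>Pow (insert a S). sum c (Pow (W \<union> B)))
      = (\<Sum>W\<in>Pow S. sum c (Pow (W \<union> B))) + (\<Sum>W\<in>Pow S. sum c (Pow (W \<union> insert a B)))"
    using insert.hyps by (simp add: sum_Pow_insert)
  also have "\<dots> = (\<Sum>A\<in>Pow B. c (S \<union> A)) + (\<Sum>A\<in>Pow (insert a B). c (S \<union> A))"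
    using insert.IH[of B] insert.IH[of "insert a B"] insert.hyps insert.prems B by simp
  also have "(\<Sum>A\<in>Pow (insert a B). c (S \<union> A))
      = (\<Sum>A\<in>Pow B. c (S \<union> A)) + (\<Sum>A\<in>Pow B. c (insert a S \<union> A))"
    using insert.prems B by (simp add: sum_Pow_insert)
  finally have "(\<Sum>W\<in>Pow (insert a S). sum c (Pow (W \<union> B)))
      = ((\<Sum>A\<in>Pow B. c (S \<union> A)) + (\<Sum>A\<in>Pow B. c (S \<union> A))) + (\<Sum>A\<in>Pow B. c (insert a S \<union> A))"
    by (simp only: add.assoc)
  then show ?case by (simp only: bit_add_self add_0)
qed

lemma sum_subcube_function:
  assumes "S \<subseteq> {1..n}" "B \<subseteq> {1..n}" "S \<inter> B = {}"
  shows "(\<Sum>W\<in>Pow S. of_nat (f (indicator_point n (W \<union> B))))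
    = (\<Sum>A\<in>Pow B. multilinear_coeff n f (S \<union> A))"
proof -
  have "(\<Sum>W\<in>Pow S. of_nat (f (indicator_point n (W \<union> B))))
      = (\<Sum>W\<in>Pow S. sum (multilinear_coeff n f) (Pow (W \<union> B)))"
    using assms by (intro sum.cong refl of_nat_eq_sum_multilinear_coeff) auto
  also have "\<dots> = (\<Sum>A\<in>Pow B. multilinear_coeff n f (S \<union> A))"
    using assms by (intro sum_subcube_eq_sum_coeffs) (auto intro: finite_subset)
  finally show ?thesis .
qed

section \<open>Shattering by the spectrum\<close>

lemma character_Un:
  assumes "finite A" "finite B" "A \<inter> B = {}"
  shows "character (A \<union> B) x = character A x * character B x"
  using assms by (simp add: character_def sum.union_disjoint power_add)

lemma sum_character_Pow:
  assumes R: "R \<subseteq> {1..n}"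
  shows "(\<Sum>A\<in>Pow R. character A (indicator_point n U)) = (if R \<inter> U = {} then 2 ^ card R else 0)"
proof -
  let ?x = "indicator_point n U"
  have fin: "finite R" using R by (rule finite_subset) simp
  have "(\<Sum>A\<in>Pow R. character A ?x) = (\<Prod>i\<in>R. (- 1) ^ ?x i + 1)"
    using fin by (subst prod_add) (simp_all add: character_def power_sum)
  also have "\<dots> = (if R \<inter> U = {} then 2 ^ card R else 0)"
  proof (cases "R \<inter> U = {}")
    case True
    then have "(\<Prod>i\<in>R. (- 1) ^ ?x i + 1) = (\<Prod>i\<in>R. 2 :: real)"
      using R by (intro prod.cong) (auto simp: indicator_point_apply subset_iff)
    then show ?thesis using True by simp
  next
    case False
    then obtain i where "i \<in> R" "i \<in> U" by blast
    then have "(\<Prod>i\<in>R. (- 1) ^ ?x i + 1) = (0 :: real)"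
      using R fin by (intro prod_zero bexI[of _ i]) (auto simp: indicator_point_apply subset_iff)
    then show ?thesis using False by simp
  qed
  finally show ?thesis .
qed

text \<open>
  Summing over all \<open>A\<close> outside \<open>T\<close> amounts to evaluating a Fourier expansion in the variables
  outside \<open>T\<close> at the origin: the characters cancel except at points that vanish outside \<open>T\<close>.
\<close>

lemma sum_fourier_coeff_outside:
  assumes T: "T \<subseteq> {1..n}" and B: "B \<subseteq> T"
  shows "(\<Sum>A\<in>Pow ({1..n} - T). fourier_coeff n f (B \<union> A))
    = 2 ^ card ({1..n} - T) / 2 ^ n
      * (\<Sum>U\<in>Pow T. real (f (indicator_point n U)) * character B (indicator_point n U))"
proof -
  let ?R = "{1..n} - T" and ?p = "indicator_point n"
  let ?g = "\<lambda>U. real (f (?p U)) * character B (?p U)"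
  have finB: "finite B" using B T by (meson finite_atLeastAtMost finite_subset)
  have coeff: "fourier_coeff n f (B \<union> A)
      = 1 / 2 ^ n * (\<Sum>U\<in>Pow {1..n}. ?g U * character A (?p U))" if "A \<in> Pow ?R" for A
  proof -
    have "finite A" "B \<inter> A = {}" using that B by (auto intro: finite_subset)
    then show ?thesis
      using finB
      by (simp add: fourier_coeff_def character_Un mult.assoc
          flip: sum.reindex_bij_betw[OF bij_betw_indicator_point])
  qed
  have "(\<Sum>A\<in>Pow ?R. fourier_coeff n f (B \<union> A))
      = 1 / 2 ^ n * (\<Sum>A\<in>Pow ?R. \<Sum>U\<in>Pow {1..n}. ?g U * character A (?p U))"
    using coeff by (simp add: sum_distrib_left)
  also have "\<dots> = 1 / 2 ^ n * (\<Sum>U\<in>Pow {1..n}. ?g U * (\<Sum>A\<in>Pow ?R. character A (?p U)))"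
    by (subst sum.swap) (simp add: sum_distrib_left)
  also have "(\<Sum>U\<in>Pow {1..n}. ?g U * (\<Sum>A\<in>Pow ?R. character A (?p U)))
      = (\<Sum>U\<in>Pow {1..n}. if U \<in> Pow T then 2 ^ card ?R * ?g U else 0)"
    by (rule sum.cong[OF refl], subst sum_character_Pow) auto
  also have "\<dots> = (\<Sum>U\<in>Pow {1..n} \<inter> Pow T. 2 ^ card ?R * ?g U)"
    by (rule sum.inter_restrict[symmetric]) simp
  also have "Pow {1..n} \<inter> Pow T = Pow T" using T by blast
  finally show ?thesis by (simp add: sum_distrib_left)
qed

lemma even_if_signed_sum_zero:
  fixes g h :: "'a \<Rightarrow> nat"
  assumes "(\<Sum>x\<in>X. real (g x) * (- 1) ^ h x) = 0"
  shows "(\<Sum>x\<in>X. of_nat (g x) :: bit) = 0"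
proof -
  have "real_of_int (\<Sum>x\<in>X. int (g x) * (- 1) ^ h x) = 0"
    using assms by simp
  then have "(\<Sum>x\<in>X. int (g x) * (- 1) ^ h x) = 0"
    by (simp only: of_int_eq_0_iff)
  then have "of_int (\<Sum>x\<in>X. int (g x) * (- 1) ^ h x) = (0 :: bit)"
    by (simp only: of_int_0)
  then show ?thesis by (simp only: of_int_sum of_int_mult of_int_of_nat_eq of_int_power of_int_minus
        of_int_1 uminus_bit_def id_apply power_one mult_1_right)
qed

text \<open>
  A pattern \<open>B\<close> missed on \<open>T\<close> would force a signed sum of the values of \<open>f\<close> on the subsets of \<open>T\<close>
  to be 0. Modulo 2 the signs disappear and the sum becomes the coefficient of the monomial \<open>T\<close>.
\<close>

lemma shatters_Spec:
  assumes T: "T \<subseteq> {1..n}" and coeff: "multilinear_coeff n f T \<noteq> 0"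
  shows "shatters (Spec n f) T"
  unfolding shatters_def
proof (intro allI impI, rule ccontr)
  fix B assume B: "B \<subseteq> T" and missed: "\<not> (\<exists>A\<in>Spec n f. A \<inter> T = B)"
  have "fourier_coeff n f (B \<union> A) = 0" if "A \<in> Pow ({1..n} - T)" for A
  proof -
    have "(B \<union> A) \<inter> T = B" "B \<union> A \<subseteq> {1..n}" using that B T by auto
    then show ?thesis using missed unfolding Spec_def by blast
  qed
  then have "(\<Sum>A\<in>Pow ({1..n} - T). fourier_coeff n f (B \<union> A)) = 0" by simp
  then have "(\<Sum>U\<in>Pow T. real (f (indicator_point n U)) * character B (indicator_point n U)) = 0"
    by (subst (asm) sum_fourier_coeff_outside[OF T B]) simp
  then have "(\<Sum>U\<in>Pow T. of_nat (f (indicator_point n U)) :: bit) = 0"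
    unfolding character_def by (rule even_if_signed_sum_zero)
  then show False
    using sum_subcube_function[OF T, of "{}" f] coeff by simp
qed

section \<open>Shattering by the support\<close>

lemma mem_supp_iff: "U \<subseteq> {1..n} \<Longrightarrow> U \<in> supp n f \<longleftrightarrow> f (indicator_point n U) \<noteq> 0"
  unfolding supp_def
  by (auto simp: indicator_point_point_set point_set_indicator_point indicator_point_in_cube
      intro!: image_eqI[of _ _ "indicator_point n U"])

text \<open>
  Fixing the variables outside \<open>S\<close> to \<open>B\<close> can change the coefficient of \<open>S\<close> only by contributions
  from proper supersets of \<open>S\<close>. There are none, so this restriction of \<open>f\<close> is not zero, and any
  point at which it is nonzero witnesses the pattern \<open>B\<close>.
\<close>

lemma shatters_supp:
  assumes S: "S \<subseteq> {1..n}" and coeff: "multilinear_coeff n f S \<noteq> 0"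
    and maximal: "\<And>S'. S \<subset> S' \<Longrightarrow> S' \<subseteq> {1..n} \<Longrightarrow> multilinear_coeff n f S' = 0"
  shows "shatters (supp n f) ({1..n} - S)"
  unfolding shatters_def
proof (intro allI impI)
  fix B assume B: "B \<subseteq> {1..n} - S"
  then have finB: "finite B" by (rule finite_subset) simp
  have "(\<Sum>W\<in>Pow S. of_nat (f (indicator_point n (W \<union> B))))
      = (\<Sum>A\<in>Pow B. multilinear_coeff n f (S \<union> A))"
    using S B by (intro sum_subcube_function) auto
  also have "\<dots> = (\<Sum>A\<in>{{}}. multilinear_coeff n f (S \<union> A))"
    using finB S B by (intro sum.mono_neutral_right) (auto intro!: maximal)
  also have "\<dots> \<noteq> 0" using coeff by simp
  finally obtain W where W: "W \<subseteq> S" "(of_nat (f (indicator_point n (W \<union> B))) :: bit) \<noteq> 0"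
    by (metis (no_types, lifting) PowD sum.neutral)
  then have "f (indicator_point n (W \<union> B)) \<noteq> 0" by (intro notI) simp
  moreover have "W \<union> B \<subseteq> {1..n}" using W S B by auto
  ultimately have "W \<union> B \<in> supp n f" by (simp add: mem_supp_iff)
  moreover have "(W \<union> B) \<inter> ({1..n} - S) = B" using W B by auto
  ultimately show "\<exists>A\<in>supp n f. A \<inter> ({1..n} - S) = B" by blast
qed

section \<open>The degree bounds\<close>

lemma card_le_VC:
  assumes "T \<subseteq> {1..n}" "shatters F T"
  shows "card T \<le> VC n F"
  unfolding VC_def using assms by (intro Max_ge) auto

lemma degree_F2_attained:
  assumes "f \<in> cube n \<rightarrow> {0, 1}" and "\<exists>x\<in>cube n. f x \<noteq> 0"
  obtains S where "S \<subseteq> {1..n}" "multilinear_coeff n f S \<noteq> 0" "card S = degree_F2 n f"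
    "\<And>S'. S' \<subseteq> {1..n} \<Longrightarrow> multilinear_coeff n f S' \<noteq> 0 \<Longrightarrow> card S' \<le> card S"
proof -
  let ?M = "{S. S \<subseteq> {1..n} \<and> multilinear_coeff n f S \<noteq> 0}"
  obtain x where x: "x \<in> cube n" "f x = 1" using assms by (auto simp: Pi_iff)
  let ?U = "point_set n x"
  have U: "?U \<subseteq> {1..n}" by (auto simp: point_set_def)
  have "sum (multilinear_coeff n f) (Pow ?U) = 1"
    using of_nat_eq_sum_multilinear_coeff[OF U, of f] x by (simp add: indicator_point_point_set)
  then have "\<exists>S\<in>Pow ?U. multilinear_coeff n f S \<noteq> 0"
    by (metis sum.neutral zero_neq_one)
  then have nonempty: "card ` ?M \<noteq> {}" using U by blast
  have fin: "finite (card ` ?M)" by simp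
  obtain S where S: "S \<in> ?M" "card S = Max (card ` ?M)"
    using Max_in[OF fin nonempty] by auto
  moreover have "card S' \<le> card S" if "S' \<in> ?M" for S'
    using S(2) fin that by simp
  ultimately show ?thesis using that by (auto simp: degree_F2_def)
qed

theorem theorem4p1:
  fixes n :: nat and f :: "(nat \<Rightarrow> nat) \<Rightarrow> nat"
  assumes "f \<in> cube n \<rightarrow> {0, 1}"
    and "\<exists>x\<in>cube n. f x \<noteq> 0"
  shows "VC n (Spec n f) \<ge> degree_F2 n f
    \<and> VC n (supp n f) + VC n (Spec n f) \<ge> n
    \<and> (\<forall>d. VC n (supp n f) = d \<longrightarrow>
          (\<exists>T. T \<subseteq> {1..n} \<and> shatters (Spec n f) T \<and> card T \<ge> n - d))"
proof -
  obtain S where S: "S \<subseteq> {1..n}" "multilinear_coeff n f S \<noteq> 0" "card S = degree_F2 n f"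
    and max: "\<And>S'. S' \<subseteq> {1..n} \<Longrightarrow> multilinear_coeff n f S' \<noteq> 0 \<Longrightarrow> card S' \<le> card S"
    using degree_F2_attained[OF assms] by blast
  have Spec: "shatters (Spec n f) S" using S by (intro shatters_Spec)
  then have Spec_bound: "card S \<le> VC n (Spec n f)" using S by (intro card_le_VC)
  have "multilinear_coeff n f S' = 0" if "S \<subset> S'" "S' \<subseteq> {1..n}" for S'
    using max[of S'] psubset_card_mono[OF finite_subset[OF that(2)] that(1)] that(2) by fastforce
  then have "shatters (supp n f) ({1..n} - S)" using S by (intro shatters_supp)
  then have "card ({1..n} - S) \<le> VC n (supp n f)" by (intro card_le_VC) auto
  then have supp_bound: "n - card S \<le> VC n (supp n f)"
    using S(1) by (simp add: card_Diff_subset finite_subset)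
  show ?thesis
  proof (intro conjI allI impI)
    show "VC n (Spec n f) \<ge> degree_F2 n f" using Spec_bound S(3) by simp
    show "VC n (supp n f) + VC n (Spec n f) \<ge> n" using Spec_bound supp_bound by simp
    fix d assume "VC n (supp n f) = d"
    then have "card S \<ge> n - d" using supp_bound by simp
    then show "\<exists>T. T \<subseteq> {1..n} \<and> shatters (Spec n f) T \<and> card T \<ge> n - d"
      using S(1) Spec by blast
  qed
qed

end
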